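(* Let $\mu$ be a Borel probability measure with bounded support on $\mathbb{R}^d$. Then $$\underline{\dim}_{\rm C}\mu=\liminf_{R\to\infty}\frac{\log\Big(R^{-d}\int_{|z|\le R}|\widehat{\mu}(z)|^2\,dz\Big)}{-\log R}$$ and $$\overline{\dim}_{\rm C}\mu=\limsup_{R\to\infty}\frac{\log\Big(R^{-d}\int_{|z|\le R}|\widehat{\mu}(z)|^2\,dz\Big)}{-\log R}.$$
   Context: $B(x,r)$ is the closed Euclidean ball in $\mathbb{R}^d$ with centre $x$ and radius $r$. The Fourier transform of $\mu$ is $\widehat{\mu}(z)=\int e^{i x\cdot z}\,d\mu(x)$, $z\in\mathbb{R}^d$. The lower and upper correlation dimensions of $\mu$ are $$\underline{\dim}_{\rm C}\mu=\liminf_{r\to0}\frac{\log\int\mu(B(x,r))\,d\mu(x)}{\log r},\qquad \overline{\dim}_{\rm C}\mu=\limsup_{r\to0}\frac{\log\int\mu(B(x,r))\,d\mu(x)}{\log r}.$$ *)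

theory Defs
  imports "HOL-Probability.Probability"
begin

text \<open>The support of a Borel measure: the smallest closed set whose complement is null.\<close>

definition msupport :: "(real ^ 'd) measure \<Rightarrow> (real ^ 'd) set" where
  "msupport \<mu> = \<Inter> {F. closed F \<and> emeasure \<mu> (- F) = 0}"

definition fourier_transform :: "(real ^ 'd) measure \<Rightarrow> real ^ 'd \<Rightarrow> complex" where
  "fourier_transform \<mu> z = (LINT x|\<mu>. exp (\<i> * complex_of_real (x \<bullet> z)))"

text \<open>
  The logarithms below are real logarithms, and the quotients are embedded into the extended
  reals, so that lower and upper limits always exist. No junk value of \<^const>\<open>ln\<close> is involved: for a
  probability measure on the Borel sets both integrals are finite and strictly positive for
  positive radii (the second one because the Fourier transform is continuous with value 1 at 0).
\<close>

definition correlation_quotient :: "(real ^ 'd) measure \<Rightarrow> real \<Rightarrow> real" where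
  "correlation_quotient \<mu> r = ln (LINT x|\<mu>. measure \<mu> (cball x r)) / ln r"

definition lower_correlation_dim :: "(real ^ 'd) measure \<Rightarrow> ereal" where
  "lower_correlation_dim \<mu> = Liminf (at_right 0) (\<lambda>r. ereal (correlation_quotient \<mu> r))"

definition upper_correlation_dim :: "(real ^ 'd) measure \<Rightarrow> ereal" where
  "upper_correlation_dim \<mu> = Limsup (at_right 0) (\<lambda>r. ereal (correlation_quotient \<mu> r))"

end

theory Submission
  imports Defs
begin

text \<open>
  Write \<open>C(r)\<close> for the correlation integral \<open>\<integral> \<mu>(B(x,r)) d\<mu>(x)\<close> and \<open>J(R)\<close> for the mean
  \<open>R\<^sup>-\<^sup>d \<integral>\<^bsub>|z| \<le> R\<^esub> |\<mu>^(z)|\<^sup>2 dz\<close>, where \<open>\<mu>^\<close> is the Fourier transform. The two are comparable up to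
  constants that depend only on the dimension:
  \<open>c C(1/R) \<le> J(R) \<le> c' C(1/R)\<close> for every \<open>R > 0\<close>. After taking logarithms and dividing by
  \<open>-ln R\<close>, the constants contribute a term that tends to 0, so the two quotients have the same
  lower and upper limits.

  The comparison rests on a Parseval identity. Since \<open>|\<mu>^(z)|\<^sup>2\<close> is the integral of
  \<open>exp(i (x - y) \<bullet> z)\<close> over \<open>(x,y)\<close> with respect to \<open>\<mu> \<times> \<mu>\<close>, Fubini turns the integral of a kernel
  \<open>k(z)\<close> against \<open>|\<mu>^|\<^sup>2\<close> into the integral of the Fourier transform of \<open>k\<close> at \<open>x - y\<close>
  (\<open>parseval_product_kernel\<close>). In the same notation, \<open>C(r)\<close> is the integral of
  the indicator of \<open>|x - y| \<le> r\<close> with respect to \<open>\<mu> \<times> \<mu>\<close>.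

  Two product kernels suffice, built from the tent function \<open>max 0 (1 - |x|)\<close> and the
  Fejer function \<open>2 (1 - cos x) / x\<^sup>2\<close>. Both are nonnegative, and up to a constant factor each is
  the Fourier transform of the other. A tent kernel lies below the indicator of the ball of
  radius \<open>R\<close>, and its transform is a Fejer kernel, which is nonnegative everywhere and bounded below near 0:
  this bounds \<open>J(R)\<close> from below (\<open>correlation_integral_le_fourier\<close>). A multiple of a Fejer kernel
  lies above that indicator, and its transform is a tent kernel, which is bounded and supported near
  0: this bounds \<open>J(R)\<close> from above (\<open>fourier_le_correlation_integral\<close>). The tent is the compactly
  supported side in both cases, in frequency for the lower bound and in space for the upper bound, so
  no tail has to be estimated.
\<close>

section \<open>Integrals of product functions\<close>

text \<open>
  The Lebesgue measure is the image of the product of its one-dimensional copies, so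
  the identity is inherited from finite products of measures.
\<close>
lemma lborel_prod_Basis:
  fixes f :: "'a::euclidean_space \<Rightarrow> real \<Rightarrow> 'b::{real_normed_field,banach,second_countable_topology}"
  assumes int: "\<And>b. b \<in> Basis \<Longrightarrow> integrable lborel (f b)"
  shows "integrable lborel (\<lambda>x::'a. \<Prod>b\<in>Basis. f b (x \<bullet> b))" (is ?I)
    and "(LINT x::'a|lborel. (\<Prod>b\<in>Basis. f b (x \<bullet> b))) = (\<Prod>b\<in>Basis. LINT t|lborel. f b t)" (is ?E)
proof -
  interpret product_sigma_finite "\<lambda>b::'a. lborel :: real measure" ..
  have [measurable]: "f b \<in> borel_measurable borel" if "b \<in> Basis" for b
    using int[OF that] by (auto dest: borel_measurable_integrable)
  have coord: "(\<Prod>b\<in>Basis. f b ((\<Sum>c\<in>Basis. g c *\<^sub>R c) \<bullet> b)) = (\<Prod>b\<in>Basis. f b (g b))" for g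
    by (intro prod.cong) auto
  have mf: "(\<lambda>x::'a. \<Prod>b\<in>Basis. f b (x \<bullet> b)) \<in> borel_measurable borel"
    by measurable
  have mc: "(\<lambda>g. \<Sum>b\<in>Basis. g b *\<^sub>R b) \<in> (\<Pi>\<^sub>M b\<in>Basis. lborel) \<rightarrow>\<^sub>M (borel :: 'a measure)"
    by measurable
  show ?I
    unfolding lborel_eq[where 'a='a] integrable_distr_eq[OF mc mf] coord
    by (intro product_integrable_prod int) auto
  show ?E
    unfolding lborel_eq[where 'a='a] integral_distr[OF mc mf] coord
    by (intro product_integral_prod int) auto
qed

section \<open>The tent function and the Fejer function\<close>

text \<open>
  The value at 0 is the continuous extension. With it, the pointwise identity \<open>fejer_cos\<close> and the lower
  bound \<open>fejer_ge_half\<close> hold at 0 as well.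
\<close>
definition fejer :: "real \<Rightarrow> real" where
  "fejer x = (if x = 0 then 1 else 2 * (1 - cos x) / x\<^sup>2)"

definition tent :: "real \<Rightarrow> real" where
  "tent x = max 0 (1 - \<bar>x\<bar>)"

lemma borel_measurable_fejer [measurable]: "fejer \<in> borel_measurable borel"
  unfolding fejer_def[abs_def] by measurable

lemma borel_measurable_tent [measurable]: "tent \<in> borel_measurable borel"
  unfolding tent_def[abs_def] by measurable

lemma fejer_minus [simp]: "fejer (- x) = fejer x"
  by (simp add: fejer_def)

lemma tent_minus [simp]: "tent (- x) = tent x"
  by (simp add: tent_def)

lemma tent_eq_0: "1 \<le> \<bar>x\<bar> \<Longrightarrow> tent x = 0"
  by (simp add: tent_def)

lemma fejer_nonneg: "0 \<le> fejer x"
  by (simp add: fejer_def)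

lemma integrable_tent: "integrable lborel tent"
proof (rule Bochner_Integration.integrable_bound)
  show "integrable lborel (indicator {-1..1::real} :: real \<Rightarrow> real)" by simp
qed (auto simp: tent_def indicator_def)

text \<open>
  The tent is even, so its transform is twice the integral over the half \<open>[0,1]\<close>, where it is the
  polynomial \<open>1 - x\<close> and the integral is elementary.
\<close>
lemma integral_tent_cos: "(LINT x|lborel. tent x * cos (t * x)) = fejer t"
proof -
  define q where "q x = indicator {0..1} x * ((1 - x) * cos (t * x))" for x :: real
  have q: "has_bochner_integral lborel q (fejer t / 2)"
  proof (cases "t = 0")
    case True
    have "has_bochner_integral lborel (\<lambda>x::real. (1 - x) * indicator {0..1} x) ((1 - 1\<^sup>2/2) - (0 - 0\<^sup>2/2))"
      by (rule has_bochner_integral_FTC_Icc_real[of 0 1 "\<lambda>x. x - x\<^sup>2/2"])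
         (auto intro!: derivative_eq_intros)
    then show ?thesis using True by (simp add: q_def[abs_def] fejer_def mult_ac)
  next
    case False
    let ?H = "\<lambda>x. (1 - x) * sin (t * x) / t - cos (t * x) / t\<^sup>2"
    have "has_bochner_integral lborel (\<lambda>x::real. ((1 - x) * cos (t * x)) * indicator {0..1} x) (?H 1 - ?H 0)"
      using False
      by (intro has_bochner_integral_FTC_Icc_real[of 0 1 ?H])
         (auto intro!: derivative_eq_intros simp: power2_eq_square field_simps)
    then show ?thesis using False by (simp add: q_def[abs_def] fejer_def mult_ac diff_divide_distrib)
  qed
  have qm: "has_bochner_integral lborel (\<lambda>x. q (- x)) (fejer t / 2)"
    using lborel_has_bochner_integral_real_affine_iff[of "-1" q "fejer t / 2" 0] q by simp
  have "(LINT x|lborel. tent x * cos (t * x)) = (LINT x|lborel. q x + q (- x))"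
  proof (rule integral_cong_AE)
    \<comment> \<open>at 0 both halves contribute, so the equation fails there\<close>
    show "AE x in lborel. tent x * cos (t * x) = q x + q (- x)"
      using AE_lborel_singleton[of 0]
    proof eventually_elim
      case (elim x)
      then show ?case by (auto simp: q_def tent_def indicator_def)
    qed
  qed (auto simp: q_def[abs_def])
  also have "\<dots> = fejer t"
    using has_bochner_integral_integral_eq[OF has_bochner_integral_add[OF q qm]] by simp
  finally show ?thesis .
qed

lemma integral_tent: "(LINT x|lborel. tent x) = 1"
  using integral_tent_cos[of 0] by (simp add: fejer_def)

lemma integrable_tent_cos: "integrable lborel (\<lambda>x. tent x * cos (t * x))"
  by (rule Bochner_Integration.integrable_bound[OF integrable_tent])
     (simp_all add: abs_mult mult_left_le)

lemma tent_nonneg: "0 \<le> tent x"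
  by (simp add: tent_def)

text \<open>
  This bound and the lower bound near 0 come from the representation of the Fejer function as a cosine
  integral of the tent, which has total mass 1.
\<close>
lemma fejer_le_1: "fejer t \<le> 1"
proof -
  have "(LINT x|lborel. tent x * cos (t * x)) \<le> (LINT x|lborel. tent x)"
    by (intro integral_mono integrable_tent integrable_tent_cos) (simp add: mult_left_le tent_nonneg)
  then show ?thesis by (simp add: integral_tent_cos integral_tent)
qed

lemma fejer_ge_half:
  assumes "\<bar>t\<bar> \<le> 1" shows "1/2 \<le> fejer t"
proof -
  have "tent x * (1/2) \<le> tent x * cos (t * x)" for x
  proof (cases "\<bar>x\<bar> \<le> 1")
    case True
    have "\<bar>t * x\<bar> \<le> 1" using assms True by (simp add: abs_mult mult_le_one)
    \<comment> \<open>\<open>cos (pi/3) = 1/2\<close> and \<open>1 < pi/3\<close>\<close>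
    then have "cos (pi/3) \<le> cos \<bar>t * x\<bar>"
      using pi_gt3 by (intro cos_monotone_0_pi_le) auto
    then have "1/2 \<le> cos (t * x)" by (simp add: cos_60)
    then show ?thesis using tent_nonneg by (intro mult_left_mono)
  qed (simp add: tent_def)
  then have "(LINT x|lborel. tent x * (1/2)) \<le> (LINT x|lborel. tent x * cos (t * x))"
    by (intro integral_mono integrable_tent_cos) (auto intro: integrable_tent)
  then show ?thesis by (simp add: integral_tent_cos integral_tent)
qed

lemma integrable_fejer: "integrable lborel fejer"
proof (rule Bochner_Integration.integrable_bound)
  show "integrable lborel (\<lambda>x::real. 5 * (1 / (1 + x\<^sup>2)))"
    using integrable_inverse_1_plus_square
    by (simp add: set_integrable_def einterval_def divide_inverse)
  show "AE x in lborel. norm (fejer x) \<le> norm (5 * (1 / (1 + x\<^sup>2)))"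
  proof (intro AE_I2)
    fix x :: real
    \<comment> \<open>\<open>fejer\<close> is at most 1, which settles small \<open>x\<close>, and at most \<open>4 / x\<^sup>2\<close>, which settles large \<open>x\<close>\<close>
    have "x\<^sup>2 * fejer x \<le> 4"
    proof (cases "x = 0")
      case False
      then have "x\<^sup>2 * fejer x = 2 * (1 - cos x)" by (simp add: fejer_def)
      also have "\<dots> \<le> 2 * 2" by (intro mult_left_mono) auto
      finally show ?thesis by simp
    qed simp
    then have "(1 + x\<^sup>2) * fejer x \<le> 5" using fejer_le_1[of x] by (simp add: algebra_simps)
    moreover have "0 < 1 + x\<^sup>2" by (simp add: add_pos_nonneg)
    ultimately show "norm (fejer x) \<le> norm (5 * (1 / (1 + x\<^sup>2)))"
      using fejer_nonneg[of x] by (simp add: field_simps)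
  qed
qed simp

text \<open>
  The function \<open>a\<^sup>2 fejer(a x)\<close> is \<open>2 (1 - cos (a x)) / x\<^sup>2\<close>. That its integral is a multiple of
  \<open>|a|\<close> follows from scaling alone; this is where the kink of the tent function comes from.
\<close>
lemma integral_fejer_scaled:
  "integrable lborel (\<lambda>x. a\<^sup>2 * fejer (a * x))"
  "(LINT x|lborel. a\<^sup>2 * fejer (a * x)) = \<bar>a\<bar> * (LINT x|lborel. fejer x)"
proof -
  show "integrable lborel (\<lambda>x. a\<^sup>2 * fejer (a * x))"
    using lborel_integrable_real_affine[OF integrable_fejer, of a 0] by (cases "a = 0") auto
  show "(LINT x|lborel. a\<^sup>2 * fejer (a * x)) = \<bar>a\<bar> * (LINT x|lborel. fejer x)"
    using lborel_integral_real_affine[of a fejer 0]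
    by (cases "a = 0") (auto simp: power2_eq_square abs_mult[symmetric])
qed

text \<open>
  The product formula for cosines writes \<open>(1 - cos x) cos (t x)\<close> as a combination of terms
  \<open>1 - cos (a x)\<close>, each of which becomes integrable on division by \<open>x\<^sup>2\<close>.
\<close>
lemma fejer_cos:
  "fejer x * cos (t * x) =
    ((1 + t)\<^sup>2 * fejer ((1 + t) * x) + (1 - t)\<^sup>2 * fejer ((1 - t) * x)
      - 2 * (t\<^sup>2 * fejer (t * x))) / 2"
proof (cases "x = 0")
  case True
  then show ?thesis by (simp add: fejer_def power2_eq_square algebra_simps)
next
  case False
  have sc: "a\<^sup>2 * fejer (a * x) = 2 * (1 - cos (a * x)) / x\<^sup>2" for a
    using False by (auto simp: fejer_def power_mult_distrib)
  have "2 * cos x * cos (t * x) = cos ((1 + t) * x) + cos ((1 - t) * x)"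
    by (simp add: distrib_right left_diff_distrib cos_add cos_diff)
  then have eq: "2 * (1 - cos x) * cos (t * x) =
      (1 - cos ((1 + t) * x)) + (1 - cos ((1 - t) * x)) - 2 * (1 - cos (t * x))"
    by (simp add: algebra_simps)
  have "fejer x * cos (t * x) = 2 * (1 - cos x) * cos (t * x) / x\<^sup>2"
    using False by (simp add: fejer_def)
  then show ?thesis
    unfolding eq sc by (simp add: diff_divide_distrib add_divide_distrib)
qed

text \<open>
  Integrating the previous identity gives half the integral of \<open>fejer\<close> times the second difference
  \<open>|1 + t| + |1 - t| - 2 |t|\<close>, which is twice the tent. In this way the inversion formula for the tent
  function is obtained without an inversion theorem. The constant, \<open>2 \<pi>\<close>, is left
  as an integral.
\<close>
lemma integral_fejer_cos:
  "(LINT x|lborel. fejer x * cos (t * x)) = (LINT x|lborel. fejer x) * tent t"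
proof -
  have "(LINT x|lborel. fejer x * cos (t * x)) =
     (\<bar>1 + t\<bar> * (LINT x|lborel. fejer x) + \<bar>1 - t\<bar> * (LINT x|lborel. fejer x)
       - 2 * (\<bar>t\<bar> * (LINT x|lborel. fejer x))) / 2"
    unfolding fejer_cos integral_fejer_scaled(2)[symmetric]
    using integral_fejer_scaled(1)[of "1 + t"] integral_fejer_scaled(1)[of "1 - t"] integral_fejer_scaled(1)[of t]
    by (simp del: mult_zero_left integral_mult_right_zero)
  also have "\<dots> = (LINT x|lborel. fejer x) * ((\<bar>1 + t\<bar> + \<bar>1 - t\<bar> - 2 * \<bar>t\<bar>) / 2)"
    by (simp add: algebra_simps)
  also have "(\<bar>1 + t\<bar> + \<bar>1 - t\<bar> - 2 * \<bar>t\<bar>) / 2 = tent t"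
    by (auto simp: tent_def abs_if max_def)
  finally show ?thesis .
qed

lemma integral_fejer_pos: "0 < (LINT x|lborel. fejer x)"
proof -
  have "(LINT x::real|lborel. indicator {-1..1} x * (1/2)) \<le> (LINT x|lborel. fejer x)"
    by (intro integral_mono integrable_fejer)
       (use fejer_ge_half in \<open>auto simp: fejer_nonneg abs_le_iff split: split_indicator\<close>)
  then show ?thesis by simp
qed

section \<open>A Parseval identity for product kernels\<close>

lemma fourier_even:
  fixes k :: "real \<Rightarrow> real"
  assumes k: "integrable lborel k" and even: "\<And>x. k (- x) = k x"
  shows "integrable lborel (\<lambda>x. complex_of_real (k x) * exp (\<i> * complex_of_real (t * x)))"
    and "(LINT x|lborel. complex_of_real (k x) * exp (\<i> * complex_of_real (t * x)))
       = complex_of_real (LINT x|lborel. k x * cos (t * x))"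
proof -
  have [measurable]: "k \<in> borel_measurable borel"
    using k by (auto dest: borel_measurable_integrable)
  have c: "integrable lborel (\<lambda>x. k x * cos (t * x))" and s: "integrable lborel (\<lambda>x. k x * sin (t * x))"
    by (rule Bochner_Integration.integrable_bound[OF k]; simp add: abs_mult mult_left_le)+
  have eq: "complex_of_real (k x) * exp (\<i> * complex_of_real (t * x)) =
      complex_of_real (k x * cos (t * x)) + \<i> * complex_of_real (k x * sin (t * x))" for x
    unfolding exp_Euler cos_of_real sin_of_real by (simp add: algebra_simps)
  \<comment> \<open>the sine part is odd, so the reflection \<open>x \<mapsto> -x\<close> shows that its integral vanishes\<close>
  have "(LINT x|lborel. k x * sin (t * x)) = (LINT x|lborel. - (k x * sin (t * x)))"
    using lborel_integral_real_affine[of "-1" "\<lambda>x. k x * sin (t * x)" 0] by (simp add: even)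
  then have "(LINT x|lborel. k x * sin (t * x)) = 0" by simp
  then show "(LINT x|lborel. complex_of_real (k x) * exp (\<i> * complex_of_real (t * x)))
       = complex_of_real (LINT x|lborel. k x * cos (t * x))"
    unfolding eq using c s by (simp del: of_real_mult)
  show "integrable lborel (\<lambda>x. complex_of_real (k x) * exp (\<i> * complex_of_real (t * x)))"
    unfolding eq using c s by (simp del: of_real_mult)
qed

lemma cmod_fourier_square:
  fixes M :: "(real ^ 'd) measure"
  assumes "prob_space M" and sM [measurable_cong]: "sets M = sets borel"
  shows "complex_of_real ((cmod (fourier_transform M z))\<^sup>2) =
    (LINT p|(M \<Otimes>\<^sub>M M). exp (\<i> * complex_of_real ((fst p - snd p) \<bullet> z)))"
proof -
  interpret prob_space M by fact
  interpret MM: pair_prob_space M M ..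
  define e where "e x = exp (\<i> * complex_of_real (x \<bullet> z))" for x
  have [measurable]: "e \<in> borel_measurable borel"
    unfolding e_def[abs_def] by measurable
  have [measurable]: "cnj \<in> borel_measurable borel"
    by (intro borel_measurable_continuous_onI continuous_intros)
  have ne: "cmod (e x) = 1" for x by (simp add: e_def)
  have ie: "integrable M e"
    by (rule integrable_const_bound[of _ 1]) (auto simp: ne)
  have ip: "integrable (M \<Otimes>\<^sub>M M) (\<lambda>p. e (fst p) * cnj (e (snd p)))"
    by (rule MM.P.integrable_const_bound[of _ 1]) (auto simp: ne norm_mult)
  have "complex_of_real ((cmod (fourier_transform M z))\<^sup>2) = (LINT x|M. e x) * (LINT y|M. cnj (e y))"
    using ie by (simp only: fourier_transform_def e_def[abs_def, symmetric] complex_norm_square integral_bounded_linear[OF bounded_linear_cnj ie])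
  also have "\<dots> = (LINT x|M. LINT y|M. e x * cnj (e y))"
    using ie by simp
  also have "\<dots> = (LINT p|(M \<Otimes>\<^sub>M M). e (fst p) * cnj (e (snd p)))"
    using MM.integral_fst'[OF ip] by simp
  also have "(\<lambda>p. e (fst p) * cnj (e (snd p))) = (\<lambda>p. exp (\<i> * complex_of_real ((fst p - snd p) \<bullet> z)))"
    by (simp add: fun_eq_iff e_def exp_cnj exp_add[symmetric] inner_diff_left algebra_simps)
  finally show ?thesis .
qed

text \<open>
  The kernel and the character \<open>exp(i (x - y) \<bullet> z)\<close> both factor over the coordinates of \<open>z\<close>, so after
  Fubini the inner integral is a product of one-dimensional Fourier transforms, real by evenness.
\<close>
lemma parseval_product_kernel:
  fixes M :: "(real ^ 'd) measure" and k K :: "real \<Rightarrow> real"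
  assumes "prob_space M" and sM [measurable_cong]: "sets M = sets borel"
    and k: "integrable lborel k" and even: "\<And>x. k (- x) = k x"
    and K: "\<And>t. (LINT x|lborel. k x * cos (t * x)) = K t"
  shows "(LINT z|lborel. (\<Prod>b\<in>Basis. k (z \<bullet> b)) * (cmod (fourier_transform M z))\<^sup>2) =
    (LINT p|(M \<Otimes>\<^sub>M M). (\<Prod>b\<in>Basis. K ((fst p - snd p) \<bullet> b)))"
proof -
  interpret prob_space M by fact
  interpret MM: pair_prob_space M M ..
  interpret L: pair_sigma_finite "lborel :: (real ^ 'd) measure" "M \<Otimes>\<^sub>M M" ..
  have [measurable]: "k \<in> borel_measurable borel"
    using k by (auto dest: borel_measurable_integrable)
  define g :: "real ^ 'd \<Rightarrow> (real ^ 'd) \<times> (real ^ 'd) \<Rightarrow> complex" where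
    "g z p = complex_of_real (\<Prod>b\<in>Basis. k (z \<bullet> b)) * exp (\<i> * complex_of_real ((fst p - snd p) \<bullet> z))" for z p
  have ng: "cmod (g z p) = norm (\<Prod>b\<in>Basis. k (z \<bullet> b))" for z p
    by (simp add: g_def norm_mult prod_norm del: of_real_prod)
  have ik: "integrable lborel (\<lambda>z::real^'d. \<Prod>b\<in>Basis. k (z \<bullet> b))"
    by (intro lborel_prod_Basis k)
  have mg: "case_prod g \<in> borel_measurable (lborel \<Otimes>\<^sub>M (M \<Otimes>\<^sub>M M))"
    unfolding g_def[abs_def] by measurable
  have ig: "integrable (lborel \<Otimes>\<^sub>M (M \<Otimes>\<^sub>M M)) (case_prod g)"
  proof (rule L.Fubini_integrable[OF mg])
    show "integrable lborel (\<lambda>z. LINT p|(M \<Otimes>\<^sub>M M). cmod (case (z, p) of (z, p) \<Rightarrow> g z p))"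
      using ik by (simp add: ng MM.P.prob_space)
    show "AE z in lborel. integrable (M \<Otimes>\<^sub>M M) (\<lambda>p. case (z, p) of (z, p) \<Rightarrow> g z p)"
    proof (intro AE_I2)
      fix z :: "real ^ 'd"
      have "g z \<in> borel_measurable (M \<Otimes>\<^sub>M M)"
        unfolding g_def[abs_def] by measurable
      then show "integrable (M \<Otimes>\<^sub>M M) (\<lambda>p. case (z, p) of (z, p) \<Rightarrow> g z p)"
        by (intro MM.P.integrable_const_bound[of _ "norm (\<Prod>b\<in>Basis. k (z \<bullet> b))"]) (auto simp: ng)
    qed
  qed
  have inner: "(LINT z|lborel. g z p) = complex_of_real (\<Prod>b\<in>Basis. K ((fst p - snd p) \<bullet> b))" for p
  proof -
    have "g z p = (\<Prod>b\<in>Basis. complex_of_real (k (z \<bullet> b)) *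
        exp (\<i> * complex_of_real (((fst p - snd p) \<bullet> b) * (z \<bullet> b))))" for z
      unfolding g_def euclidean_inner[of "fst p - snd p" z]
      by (simp only: of_real_sum sum_distrib_left exp_sum[OF finite_Basis] of_real_prod prod.distrib)
    then show ?thesis
      using lborel_prod_Basis(2)[where f="\<lambda>b x. complex_of_real (k x) *
        exp (\<i> * complex_of_real (((fst p - snd p) \<bullet> b) * x))"] fourier_even[OF k even]
      by (simp only: K of_real_prod)
  qed
  have "complex_of_real (LINT z|lborel. (\<Prod>b\<in>Basis. k (z \<bullet> b)) * (cmod (fourier_transform M z))\<^sup>2)
      = (LINT z|lborel. LINT p|(M \<Otimes>\<^sub>M M). g z p)"
    unfolding integral_complex_of_real[symmetric] g_def of_real_mult cmod_fourier_square[OF assms(1,2)]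
    by simp
  also have "\<dots> = (LINT p|(M \<Otimes>\<^sub>M M). LINT z|lborel. g z p)"
    by (rule L.Fubini_integral[OF ig, symmetric])
  also have "\<dots> = complex_of_real (LINT p|(M \<Otimes>\<^sub>M M). (\<Prod>b\<in>Basis. K ((fst p - snd p) \<bullet> b)))"
    unfolding inner by (simp only: integral_complex_of_real)
  finally show ?thesis by (simp only: of_real_eq_iff)
qed

lemma parseval_product_kernel_scaled:
  fixes M :: "(real ^ 'd) measure" and k K :: "real \<Rightarrow> real"
  assumes "prob_space M" and "sets M = sets borel"
    and k: "integrable lborel k" and even: "\<And>x. k (- x) = k x"
    and K: "\<And>t. (LINT x|lborel. k x * cos (t * x)) = K t"
    and a: "0 < a"
  shows "(LINT z|lborel. (\<Prod>b\<in>Basis. k (z \<bullet> b / a)) * (cmod (fourier_transform M z))\<^sup>2) =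
    a ^ CARD('d) * (LINT p|(M \<Otimes>\<^sub>M M). (\<Prod>b\<in>Basis. K (a * ((fst p - snd p) \<bullet> b))))"
proof -
  have "(LINT x|lborel. k (x / a) * cos (t * x)) = a * K (a * t)" for t
    using lborel_integral_real_affine[of a "\<lambda>x. k (x / a) * cos (t * x)" 0] a K[of "a * t"]
    by (simp add: mult_ac)
  moreover have "integrable lborel (\<lambda>x. k (x / a))"
    using lborel_integrable_real_affine[OF k, of "inverse a" 0] a by (simp add: divide_inverse mult_ac)
  ultimately have "(LINT z|lborel. (\<Prod>b\<in>Basis. k (z \<bullet> b / a)) * (cmod (fourier_transform M z))\<^sup>2) =
      (LINT p|(M \<Otimes>\<^sub>M M). (\<Prod>b\<in>Basis. a * K (a * ((fst p - snd p) \<bullet> b))))"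
    using even by (intro parseval_product_kernel assms(1,2)) auto
  also have "\<dots> = a ^ CARD('d) * (LINT p|(M \<Otimes>\<^sub>M M). (\<Prod>b\<in>Basis. K (a * ((fst p - snd p) \<bullet> b))))"
    by (simp add: prod.distrib)
  finally show ?thesis .
qed

text \<open>
  In this form the correlation integral can be compared, pointwise in \<open>(x,y)\<close>, with the kernels that
  the Parseval identity produces.
\<close>
lemma correlation_integral_eq:
  fixes M :: "'a::euclidean_space measure"
  assumes "prob_space M" and sM [measurable_cong]: "sets M = sets borel"
  shows "(LINT x|M. measure M (cball x r)) =
    (LINT p|(M \<Otimes>\<^sub>M M). indicator (cball 0 r) (fst p - snd p))"
proof -
  interpret prob_space M by fact
  interpret MM: pair_prob_space M M ..
  have [measurable]: "cball 0 r \<in> sets (borel :: 'a measure)" by simp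
  have i: "integrable (M \<Otimes>\<^sub>M M) (\<lambda>p. indicator (cball 0 r) (fst p - snd p) :: real)"
    by (rule MM.P.integrable_const_bound[of _ 1]) (auto split: split_indicator)
  have "measure M (cball x r) = (LINT y|M. indicator (cball 0 r) (x - y))" for x
  proof -
    have "(\<lambda>y. indicator (cball 0 r) (x - y) :: real) = indicator (cball x r)"
      by (auto simp: fun_eq_iff indicator_def dist_norm norm_minus_commute)
    then show ?thesis by (simp add: sM)
  qed
  then show ?thesis using MM.integral_fst'[OF i] by simp
qed

section \<open>Comparison of the correlation integral with the Fourier mean\<close>

lemma fourier_transform_bounded:
  fixes M :: "(real ^ 'd) measure"
  assumes "prob_space M" and [measurable_cong]: "sets M = sets borel"
  shows "cmod (fourier_transform M z) \<le> 1"
proof -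
  interpret prob_space M by fact
  have "cmod (fourier_transform M z) \<le> (LINT x|M. cmod (exp (\<i> * complex_of_real (x \<bullet> z))))"
    unfolding fourier_transform_def by (rule integral_norm_bound)
  then show ?thesis by (simp add: prob_space)
qed

lemma borel_measurable_fourier_transform:
  fixes M :: "(real ^ 'd) measure"
  assumes "prob_space M" and [measurable_cong]: "sets M = sets borel"
  shows "fourier_transform M \<in> borel_measurable borel"
proof -
  interpret prob_space M by fact
  show ?thesis
    unfolding fourier_transform_def[abs_def] by measurable
qed

text \<open>
  The tent kernel is scaled to the cube of half-side \<open>R/d\<close>, which lies in the ball of radius \<open>R\<close>. Its
  transform at \<open>x - y\<close> is a product of Fejer functions, each at least \<open>1/2\<close> when \<open>|x - y| \<le> 1/R\<close>; elsewhere it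
  is discarded because it is nonnegative.
\<close>
lemma correlation_integral_le_fourier:
  fixes M :: "(real ^ 'd) measure"
  assumes M: "prob_space M" and sM [measurable_cong]: "sets M = sets borel" and R: "0 < R"
  shows "(LINT x|M. measure M (cball x (1/R))) \<le>
    (2 * real CARD('d)) ^ CARD('d) / R ^ CARD('d) *
      (LINT z:cball 0 R|lborel. (cmod (fourier_transform M z))\<^sup>2)"
proof -
  interpret prob_space M by fact
  interpret MM: pair_prob_space M M ..
  note [measurable] = borel_measurable_fourier_transform[OF M sM]
  have [measurable]: "cball 0 r \<in> sets (borel :: (real^'d) measure)" for r by simp
  let ?n = "CARD('d)"
  let ?W = "\<lambda>p :: (real^'d) \<times> (real^'d). \<Prod>b\<in>Basis. fejer (R / ?n * ((fst p - snd p) \<bullet> b))"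
  let ?V = "LINT z|lborel. (\<Prod>b\<in>Basis. tent (z \<bullet> b / (R / ?n))) * (cmod (fourier_transform M z))\<^sup>2"
  let ?J = "LINT z:cball 0 R|lborel. (cmod (fourier_transform M z))\<^sup>2"
  have n: "1 \<le> ?n" by (simp add: Suc_leI)
  have "(R / ?n) ^ ?n * (LINT p|(M \<Otimes>\<^sub>M M). ?W p) = ?V"
    using R n
    by (intro parseval_product_kernel_scaled[symmetric] M sM integrable_tent tent_minus integral_tent_cos) auto
  then have parseval: "(LINT p|(M \<Otimes>\<^sub>M M). ?W p) = ?V / (R / ?n) ^ ?n"
    using R n by (simp add: field_simps)
  have "(1/2) ^ ?n * (LINT p|(M \<Otimes>\<^sub>M M). indicator (cball 0 (1/R)) (fst p - snd p)) \<le> (LINT p|(M \<Otimes>\<^sub>M M). ?W p)"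
    unfolding integral_mult_right_zero[symmetric]
  proof (intro integral_mono)
    show "integrable (M \<Otimes>\<^sub>M M) (\<lambda>p. (1/2) ^ ?n * indicator (cball 0 (1/R)) (fst p - snd p) :: real)"
      by (intro integrable_mult_right MM.P.integrable_const_bound[of _ 1]) (auto split: split_indicator)
    show "integrable (M \<Otimes>\<^sub>M M) ?W"
      by (intro MM.P.integrable_const_bound[of _ 1])
         (auto intro!: prod_le_1 simp: prod_nonneg fejer_nonneg fejer_le_1)
  next
    fix p :: "(real^'d) \<times> (real^'d)"
    define v where "v = fst p - snd p"
    show "(1/2) ^ ?n * indicator (cball 0 (1/R)) (fst p - snd p) \<le> ?W p"
    proof (cases "norm v \<le> 1/R")
      case True
      have "(\<Prod>b\<in>(Basis :: (real^'d) set). 1/2) \<le> (\<Prod>b\<in>Basis. fejer (R / ?n * (v \<bullet> b)))"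
      proof (intro prod_mono conjI fejer_ge_half)
        fix b :: "real^'d" assume b: "b \<in> Basis"
        have "\<bar>v \<bullet> b\<bar> \<le> 1/R" using Basis_le_norm[OF b, of v] True by linarith
        then have "R * \<bar>v \<bullet> b\<bar> \<le> 1" using R by (simp add: field_simps)
        then have "R * \<bar>v \<bullet> b\<bar> \<le> ?n" using n by linarith
        then show "\<bar>R / ?n * (v \<bullet> b)\<bar> \<le> 1"
          using R n by (simp add: abs_mult field_simps)
      qed simp
      then show ?thesis using True by (simp add: v_def[symmetric])
    next
      case False
      then show ?thesis by (simp add: v_def[symmetric] prod_nonneg fejer_nonneg)
    qed
  qed
  also have "(LINT p|(M \<Otimes>\<^sub>M M). ?W p) = ?V / (R / ?n) ^ ?n"
    by (rule parseval)
  also have "\<dots> \<le> ?J / (R / ?n) ^ ?n"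
    unfolding set_lebesgue_integral_def
  proof (intro divide_right_mono integral_mono')
    show "integrable lborel (\<lambda>z. indicator (cball 0 R) z *\<^sub>R (cmod (fourier_transform M z))\<^sup>2)"
    proof (rule Bochner_Integration.integrable_bound)
      show "integrable lborel (indicator (cball 0 R) :: real^'d \<Rightarrow> real)"
        by (intro integrable_real_indicator emeasure_bounded_finite) auto
    qed (auto simp: power_le_one fourier_transform_bounded[OF M sM] split: split_indicator)
  next
    fix z :: "real^'d"
    show "(\<Prod>b\<in>Basis. tent (z \<bullet> b / (R / ?n))) * (cmod (fourier_transform M z))\<^sup>2
      \<le> indicator (cball 0 R) z *\<^sub>R (cmod (fourier_transform M z))\<^sup>2"
    proof (cases "norm z \<le> R")
      case True
      have "(\<Prod>b\<in>Basis. tent (z \<bullet> b / (R / ?n))) \<le> 1"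
        by (intro prod_le_1) (auto simp: tent_def)
      then show ?thesis using True by (auto intro!: mult_left_le_one_le prod_nonneg tent_nonneg)
    next
      case False
      \<comment> \<open>some coordinate exceeds the average \<open>R/d\<close>, because the norm is at most the sum of the coordinates\<close>
      have "\<exists>b\<in>Basis. R / ?n < \<bar>z \<bullet> b\<bar>"
      proof (rule ccontr)
        assume "\<not> ?thesis"
        then have "(\<Sum>b\<in>Basis. \<bar>z \<bullet> b\<bar>) \<le> (\<Sum>b\<in>(Basis :: (real^'d) set). R / ?n)"
          by (intro sum_mono) force
        then show False using norm_le_l1[of z] False n by simp
      qed
      then obtain b where b: "b \<in> Basis" "R / ?n < \<bar>z \<bullet> b\<bar>" by blast
      then have "tent (z \<bullet> b / (R / ?n)) = 0"
        using R n by (intro tent_eq_0) (simp add: abs_mult field_simps)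
      then have "(\<Prod>b\<in>Basis. tent (z \<bullet> b / (R / ?n))) = 0" using b(1) by (intro prod_zero) auto
      then show ?thesis by (simp only: mult_zero_left) simp
    qed
  qed (use R in auto)
  finally show ?thesis
    unfolding correlation_integral_eq[OF M sM]
    using R n by (simp add: power_mult_distrib power_divide field_simps)
qed

text \<open>
  On the ball of radius \<open>R\<close> the rescaled Fejer kernel is at least \<open>2\<^sup>-\<^sup>d\<close>. The scale \<open>a = d R\<close> is chosen
  so that its transform, a product of tents, is supported in the cube of half-side \<open>1/(d R)\<close> and hence
  in the ball of radius \<open>1/R\<close>; the tent factors are at most 1.
\<close>
lemma fourier_le_correlation_integral:
  fixes M :: "(real ^ 'd) measure"
  assumes M: "prob_space M" and sM [measurable_cong]: "sets M = sets borel" and R: "0 < R"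
  shows "(LINT z:cball 0 R|lborel. (cmod (fourier_transform M z))\<^sup>2) / R ^ CARD('d) \<le>
    (2 * real CARD('d) * (LINT x|lborel. fejer x)) ^ CARD('d) * (LINT x|M. measure M (cball x (1/R)))"
proof -
  interpret prob_space M by fact
  interpret MM: pair_prob_space M M ..
  note [measurable] = borel_measurable_fourier_transform[OF M sM]
  have [measurable]: "cball 0 r \<in> sets (borel :: (real^'d) measure)" for r by simp
  let ?n = "CARD('d)"
  let ?I = "LINT x|lborel. fejer x"
  define a where "a = ?n * R"
  have n: "1 \<le> ?n" by (simp add: Suc_leI)
  have a: "0 < a" "R \<le> a" using R n by (auto simp: a_def)
  let ?W = "\<lambda>p :: (real^'d) \<times> (real^'d). \<Prod>b\<in>Basis. ?I * tent (a * ((fst p - snd p) \<bullet> b))"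
  have "(LINT z:cball 0 R|lborel. (cmod (fourier_transform M z))\<^sup>2) \<le>
      (LINT z|lborel. 2 ^ ?n * ((\<Prod>b\<in>Basis. fejer (z \<bullet> b / a)) * (cmod (fourier_transform M z))\<^sup>2))"
    unfolding set_lebesgue_integral_def
  proof (intro integral_mono')
    have "integrable lborel (\<lambda>z::real^'d. \<Prod>b\<in>Basis. fejer (z \<bullet> b / a))"
      using lborel_integrable_real_affine[OF integrable_fejer, of "inverse a" 0] a
      by (intro lborel_prod_Basis) (simp add: divide_inverse mult_ac)
    then show "integrable lborel (\<lambda>z. 2 ^ ?n * ((\<Prod>b\<in>Basis. fejer (z \<bullet> b / a)) * (cmod (fourier_transform M z))\<^sup>2))"
      by (intro integrable_mult_right, rule Bochner_Integration.integrable_bound)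
         (auto simp: abs_mult power_le_one mult_left_le fourier_transform_bounded[OF M sM])
  next
    fix z :: "real^'d"
    show "indicator (cball 0 R) z *\<^sub>R (cmod (fourier_transform M z))\<^sup>2 \<le>
       2 ^ ?n * ((\<Prod>b\<in>Basis. fejer (z \<bullet> b / a)) * (cmod (fourier_transform M z))\<^sup>2)"
    proof (cases "norm z \<le> R")
      case True
      have "(\<Prod>b\<in>(Basis :: (real^'d) set). 1/2) \<le> (\<Prod>b\<in>Basis. fejer (z \<bullet> b / a))"
      proof (intro prod_mono conjI fejer_ge_half)
        fix b :: "real^'d" assume b: "b \<in> Basis"
        have "\<bar>z \<bullet> b\<bar> \<le> a" using Basis_le_norm[OF b, of z] True a by linarith
        then show "\<bar>z \<bullet> b / a\<bar> \<le> 1" using a by simp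
      qed simp
      then have "1 \<le> 2 ^ ?n * (\<Prod>b\<in>Basis. fejer (z \<bullet> b / a))"
        by (simp add: power_one_over field_simps)
      from mult_right_mono[OF this, of "(cmod (fourier_transform M z))\<^sup>2"]
      show ?thesis using True by (simp add: mult_ac)
    qed (simp add: prod_nonneg fejer_nonneg)
  qed (simp add: prod_nonneg fejer_nonneg)
  also have "\<dots> = 2 ^ ?n * (a ^ ?n * (LINT p|(M \<Otimes>\<^sub>M M). ?W p))"
    using a integral_fejer_cos fejer_minus
    by (subst parseval_product_kernel_scaled[symmetric, OF M sM integrable_fejer]) auto
  also have "(LINT p|(M \<Otimes>\<^sub>M M). ?W p) \<le> (LINT p|(M \<Otimes>\<^sub>M M). ?I ^ ?n * indicator (cball 0 (1/R)) (fst p - snd p))"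
  proof (intro integral_mono')
    show "integrable (M \<Otimes>\<^sub>M M) (\<lambda>p. ?I ^ ?n * indicator (cball 0 (1/R)) (fst p - snd p) :: real)"
      by (intro integrable_mult_right MM.P.integrable_const_bound[of _ 1]) (auto split: split_indicator)
  next
    fix p :: "(real^'d) \<times> (real^'d)"
    define v where "v = fst p - snd p"
    have I: "0 \<le> ?I" using integral_fejer_pos by simp
    have "(\<Prod>b\<in>Basis. tent (a * (v \<bullet> b))) \<le> indicator (cball 0 (1/R)) v"
    proof (cases "norm v \<le> 1/R")
      case True
      then have "indicator (cball 0 (1/R)) v = (1::real)" by simp
      moreover have "(\<Prod>b\<in>Basis. tent (a * (v \<bullet> b))) \<le> 1"
        by (intro prod_le_1) (auto simp: tent_def)
      ultimately show ?thesis by simp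
    next
      case False
      have "\<exists>b\<in>Basis. 1/a < \<bar>v \<bullet> b\<bar>"
      proof (rule ccontr)
        assume "\<not> ?thesis"
        then have "(\<Sum>b\<in>Basis. \<bar>v \<bullet> b\<bar>) \<le> (\<Sum>b\<in>(Basis :: (real^'d) set). 1/a)"
          by (intro sum_mono) force
        then show False using norm_le_l1[of v] False n R by (simp add: a_def)
      qed
      then obtain b where b: "b \<in> Basis" "1/a < \<bar>v \<bullet> b\<bar>" by blast
      then have "tent (a * (v \<bullet> b)) = 0"
        using a by (intro tent_eq_0) (simp add: abs_mult field_simps)
      then have "(\<Prod>b\<in>Basis. tent (a * (v \<bullet> b))) = 0" using b(1) by (intro prod_zero) auto
      then show ?thesis by (simp only: indicator_pos_le)
    qed
    from mult_left_mono[OF this, of "?I ^ ?n"]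
    show "?W p \<le> ?I ^ ?n * indicator (cball 0 (1/R)) (fst p - snd p)"
      using I by (simp add: prod.distrib v_def[symmetric])
    show "0 \<le> ?I ^ ?n * indicator (cball 0 (1/R)) (fst p - snd p)" using I by simp
  qed
  finally show ?thesis
    unfolding correlation_integral_eq[OF M sM]
    using R a by (simp add: power_mult_distrib a_def field_simps)
qed

section \<open>Passage to logarithms\<close>

lemma Liminf_le_of_diff_tendsto_0:
  fixes u v :: "'a \<Rightarrow> real"
  assumes lim: "((\<lambda>x. u x - v x) \<longlongrightarrow> 0) F"
  shows "Liminf F (\<lambda>x. ereal (u x)) \<le> Liminf F (\<lambda>x. ereal (v x))"
proof (cases "F = bot")
  case False
  show ?thesis
  proof (rule ereal_le_epsilon2)
    fix e :: real assume "0 < e"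
    then have "\<forall>\<^sub>F x in F. \<bar>u x - v x\<bar> < e"
      using tendstoD[OF lim] by (simp add: dist_real_def)
    then have "\<forall>\<^sub>F x in F. ereal (u x) \<le> ereal (v x) + ereal e"
      by eventually_elim simp
    then have "Liminf F (\<lambda>x. ereal (u x)) \<le> Liminf F (\<lambda>x. ereal (v x) + ereal e)"
      by (rule Liminf_mono)
    also have "\<dots> = Liminf F (\<lambda>x. ereal (v x)) + ereal e"
      by (rule Liminf_add_ereal_right[OF False]) simp
    finally show "Liminf F (\<lambda>x. ereal (u x)) \<le> Liminf F (\<lambda>x. ereal (v x)) + ereal e" .
  qed
qed simp

lemma Liminf_eq_of_diff_tendsto_0:
  fixes u v :: "'a \<Rightarrow> real"
  assumes lim: "((\<lambda>x. u x - v x) \<longlongrightarrow> 0) F"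
  shows "Liminf F (\<lambda>x. ereal (u x)) = Liminf F (\<lambda>x. ereal (v x))"
  using Liminf_le_of_diff_tendsto_0[OF lim] Liminf_le_of_diff_tendsto_0[of v u F] tendsto_minus[OF lim]
  by (intro antisym) auto

lemma Limsup_eq_of_diff_tendsto_0:
  fixes u v :: "'a \<Rightarrow> real"
  assumes lim: "((\<lambda>x. u x - v x) \<longlongrightarrow> 0) F"
  shows "Limsup F (\<lambda>x. ereal (u x)) = Limsup F (\<lambda>x. ereal (v x))"
proof -
  have "Liminf F (\<lambda>x. ereal (- u x)) = Liminf F (\<lambda>x. ereal (- v x))"
    using tendsto_minus[OF lim] by (intro Liminf_eq_of_diff_tendsto_0) simp
  then have "- Limsup F (\<lambda>x. ereal (u x)) = - Limsup F (\<lambda>x. ereal (v x))"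
    unfolding ereal_Liminf_uminus[symmetric] by simp
  then show ?thesis by simp
qed

text \<open>
  The logarithms of comparable positive functions differ by a bounded amount. Where one function
  vanishes, so does the other, and the two logarithms are the same default value.
\<close>
lemma log_ratio_diff_tendsto_0:
  fixes f g :: "real \<Rightarrow> real"
  assumes "0 < a" "0 < b"
    and f: "\<And>R. 0 < R \<Longrightarrow> 0 \<le> f R"
    and lo: "\<And>R. 0 < R \<Longrightarrow> f R \<le> a * g R" and hi: "\<And>R. 0 < R \<Longrightarrow> g R \<le> b * f R"
  shows "((\<lambda>R. (ln (f R) - ln (g R)) / ln R) \<longlongrightarrow> 0) at_top"
proof -
  define B where "B = \<bar>ln a\<bar> + \<bar>ln b\<bar>"
  have bound: "\<bar>ln (f R) - ln (g R)\<bar> \<le> B" if R: "0 < R" for R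
  proof (cases "f R = 0")
    case True
    then have "g R = 0" using lo[OF R] hi[OF R] \<open>0 < a\<close> by (simp add: zero_le_mult_iff)
    then show ?thesis using True by (simp add: B_def)
  next
    case False
    then have fp: "0 < f R" using f[OF R] by simp
    then have gp: "0 < g R" using lo[OF R] \<open>0 < a\<close> by (smt (verit) zero_less_mult_iff)
    have "ln (f R) \<le> ln a + ln (g R)"
      using lo[OF R] fp gp \<open>0 < a\<close> by (simp flip: ln_mult_pos)
    moreover have "ln (g R) \<le> ln b + ln (f R)"
      using hi[OF R] fp gp \<open>0 < b\<close> by (simp flip: ln_mult_pos)
    ultimately show ?thesis by (simp add: B_def)
  qed
  show ?thesis
  proof (rule Lim_null_comparison)
    show "\<forall>\<^sub>F R in at_top. norm ((ln (f R) - ln (g R)) / ln R) \<le> B / ln R"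
      using eventually_gt_at_top[of 1]
    proof eventually_elim
      case (elim R)
      then show ?case using bound[of R] by (simp add: divide_right_mono)
    qed
    show "((\<lambda>R. B / ln R) \<longlongrightarrow> 0) at_top"
      by (intro real_tendsto_divide_at_top[OF tendsto_const] ln_at_top)
  qed
qed

section \<open>The correlation dimensions\<close>

theorem corollary4p4:
  fixes \<mu> :: "(real ^ 'd) measure"
  assumes "prob_space \<mu>"
    and "sets \<mu> = sets borel"
    and "bounded (msupport \<mu>)"
  shows "lower_correlation_dim \<mu> =
      Liminf at_top (\<lambda>R::real. ereal
        (ln (R powi (- int CARD('d)) *
            (LINT z:cball 0 R|lborel. (cmod (fourier_transform \<mu> z))\<^sup>2)) / (- ln R)))
    \<and> upper_correlation_dim \<mu> =
      Limsup at_top (\<lambda>R::real. ereal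
        (ln (R powi (- int CARD('d)) *
            (LINT z:cball 0 R|lborel. (cmod (fourier_transform \<mu> z))\<^sup>2)) / (- ln R)))"
proof -
  let ?n = "CARD('d)"
  define f where "f R = (LINT x|\<mu>. measure \<mu> (cball x (1/R)))" for R
  define g where "g R = R powi (- int ?n) *
    (LINT z:cball 0 R|lborel. (cmod (fourier_transform \<mu> z))\<^sup>2)" for R :: real
  have g: "g R = (LINT z:cball 0 R|lborel. (cmod (fourier_transform \<mu> z))\<^sup>2) / R ^ ?n" for R
    by (simp add: g_def power_int_minus divide_inverse)
  have "((\<lambda>R. (ln (f R) - ln (g R)) / ln R) \<longlongrightarrow> 0) at_top"
  proof (rule log_ratio_diff_tendsto_0)
    show "f R \<le> (2 * real ?n) ^ ?n * g R" if "0 < R" for R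
      using correlation_integral_le_fourier[OF assms(1,2) that] by (simp add: f_def g)
    show "g R \<le> (2 * real ?n * (LINT x|lborel. fejer x)) ^ ?n * f R" if "0 < R" for R
      using fourier_le_correlation_integral[OF assms(1,2) that] by (simp add: f_def g)
  qed (use integral_fejer_pos in \<open>auto simp: f_def\<close>)
  from tendsto_minus[OF this]
  have diff: "((\<lambda>R. ln (f R) / (- ln R) - ln (g R) / (- ln R)) \<longlongrightarrow> 0) at_top"
    by (simp add: diff_divide_distrib)
  have q: "ereal (correlation_quotient \<mu> (inverse R)) = ereal (ln (f R) / (- ln R))" for R
    by (simp add: correlation_quotient_def f_def inverse_eq_divide ln_div)
  have inv: "inj (inverse :: real \<Rightarrow> real)"
    by (simp add: inj_def)
  have lower: "lower_correlation_dim \<mu> = Liminf at_top (\<lambda>R. ereal (ln (f R) / (- ln R)))"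
    unfolding lower_correlation_dim_def at_right_to_top Liminf_filtermap_eq[OF inv] q ..
  have upper: "upper_correlation_dim \<mu> = Limsup at_top (\<lambda>R. ereal (ln (f R) / (- ln R)))"
    unfolding upper_correlation_dim_def at_right_to_top Limsup_filtermap_eq[OF inv] q ..
  show ?thesis
    unfolding lower upper g_def[symmetric]
    using Liminf_eq_of_diff_tendsto_0[OF diff] Limsup_eq_of_diff_tendsto_0[OF diff] by simp
qed

end
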